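(* Let $R$ be an integral domain with field of fractions $K$, and let $p\in\beta R\setminus\{0\}$ be an ultrafilter satisfying the following three conditions: (1) for any $A\in p$ and $\ell\in\mathbb{N}$, there exist $b,g\in A$ with $\{bg^j\}_{j=0}^{\ell}\subseteq A$; (2) for any $A\in p$ and $h,s\in R\setminus\{0\}$, there exist $a,d\in R$ for which $\{hd,ha,ha+sd\}\subseteq A$; (3) for every $\alpha\in R\setminus\{0\}$, we have $\alpha R\in p$. Let $k \in \mathbb{N}$, let $a_1,\dots,a_k,b_1,\dots,b_k,c_1,\dots,c_k\in R\setminus\{0\}$ and $n_1,\dots,n_k\in\mathbb{N}$ be such that the set $$I:=\left\{\kappa\in K : \kappa^{n_i}\in\left\{\tfrac{a_i}{c_i},\tfrac{b_i}{c_i},\tfrac{a_i+b_i}{c_i}\right\}\text{ for every }1\le i\le k\right\}$$ is nonempty. Then the system of equations $$a_ix_i+b_iy_i=c_iw_iz_i^{n_i},\qquad 1\le i\le k,$$ in the variables $x_i,y_i,w_i,z_i$ ($1\le i\le k$) has a solution with all variables in $A$ for every $A\in q$, where we may take $q=p$ if $0\in I$, and $q=\kappa\cdot p$ for any $\kappa\in I\setminus\{0\}$. In particular, this system is partition regular over $R\setminus\{0\}$.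
   Context: $\beta R$ is the set of ultrafilters on the set $R$, and $\beta R\setminus\{0\}$ denotes the set of ultrafilters on $R$ other than the principal ultrafilter at $0$. For $\kappa=\frac{u}{v}$ with $u,v\in R\setminus\{0\}$ and $A\subseteq R$, put $\kappa^{-1}A=\frac{v}{u}A=\{r\in R : \kappa r\in A\}$ (with $\kappa r$ computed in $K$), and for an ultrafilter $p$ on $R$, $\kappa\cdot p=\{A\subseteq R : \kappa^{-1}A\in p\}$. A system of equations is partition regular over a set $S$ if for every finite partition of $S$ some single cell contains values of all the variables (not necessarily distinct) satisfying all the equations. *)

theory Defs
  imports
    "HOL-Computational_Algebra.Polynomial_Factorial"
    "HOL-Library.Disjoint_Sets"
begin

text \<open>
  The ambient integral domain \<open>R\<close> is the type \<open>'a :: idom\<close>, its field of fractions \<open>K\<close> is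
  \<open>'a fract\<close>, and \<open>to_fract\<close> is the embedding of \<open>R\<close> into \<open>K\<close>. Ultrafilters are
  sets of subsets of the whole type, so that \<open>A \<in> p\<close> can be written literally.
\<close>

definition ultrafilter :: "'a set set \<Rightarrow> bool" where
  "ultrafilter p \<longleftrightarrow>
     UNIV \<in> p \<and> {} \<notin> p \<and>
     (\<forall>A B. A \<in> p \<longrightarrow> A \<subseteq> B \<longrightarrow> B \<in> p) \<and>
     (\<forall>A B. A \<in> p \<longrightarrow> B \<in> p \<longrightarrow> A \<inter> B \<in> p) \<and>
     (\<forall>A. A \<in> p \<or> - A \<in> p)"

definition principal_ultrafilter :: "'a \<Rightarrow> 'a set set" where
  "principal_ultrafilter x = {A. x \<in> A}"

text \<open>
  \<open>inv_dilate \<kappa> A\<close> is \<open>\<kappa>\<inverse>A = {r \<in> R. \<kappa> r \<in> A}\<close>, where the product \<open>\<kappa> r\<close> is computed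
  in \<open>K\<close>; elements \<open>r\<close> whose product \<open>\<kappa> r\<close> lies outside \<open>R\<close> do not belong to it.
\<close>

definition inv_dilate :: "'a::idom fract \<Rightarrow> 'a set \<Rightarrow> 'a set" where
  "inv_dilate \<kappa> A = {r. \<kappa> * to_fract r \<in> to_fract ` A}"

definition dilate_ultrafilter :: "'a::idom fract \<Rightarrow> 'a set set \<Rightarrow> 'a set set" where
  "dilate_ultrafilter \<kappa> p = {A. inv_dilate \<kappa> A \<in> p}"

text \<open>
  A system of equations is a predicate \<open>E\<close> on assignments of values to the variables. Only the
  variables in \<open>V\<close> occur in the system.
\<close>

definition solvable_in :: "'v set \<Rightarrow> (('v \<Rightarrow> 'a) \<Rightarrow> bool) \<Rightarrow> 'a set \<Rightarrow> bool" where
  "solvable_in V E A \<longleftrightarrow> (\<exists>s. (\<forall>v\<in>V. s v \<in> A) \<and> E s)"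

definition partition_regular_over :: "'v set \<Rightarrow> (('v \<Rightarrow> 'a) \<Rightarrow> bool) \<Rightarrow> 'a set \<Rightarrow> bool" where
  "partition_regular_over V E S \<longleftrightarrow>
     (\<forall>P. finite P \<longrightarrow> partition_on S P \<longrightarrow> (\<exists>C\<in>P. solvable_in V E C))"

datatype var = X nat | Y nat | W nat | Z nat

definition vars :: "nat \<Rightarrow> var set" where
  "vars k = X ` {1..k} \<union> Y ` {1..k} \<union> W ` {1..k} \<union> Z ` {1..k}"

definition eqn_system ::
  "nat \<Rightarrow> (nat \<Rightarrow> 'a::idom) \<Rightarrow> (nat \<Rightarrow> 'a) \<Rightarrow> (nat \<Rightarrow> 'a) \<Rightarrow> (nat \<Rightarrow> nat) \<Rightarrow> (var \<Rightarrow> 'a) \<Rightarrow> bool" where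
  "eqn_system k a b c n s \<longleftrightarrow>
     (\<forall>i\<in>{1..k}. a i * s (X i) + b i * s (Y i) = c i * s (W i) * s (Z i) ^ n i)"

definition ratio_set ::
  "nat \<Rightarrow> (nat \<Rightarrow> 'a::idom) \<Rightarrow> (nat \<Rightarrow> 'a) \<Rightarrow> (nat \<Rightarrow> 'a) \<Rightarrow> (nat \<Rightarrow> nat) \<Rightarrow> 'a fract set" where
  "ratio_set k a b c n =
     {\<kappa>. \<forall>i\<in>{1..k}. \<kappa> ^ n i \<in> {Fract (a i) (c i), Fract (b i) (c i), Fract (a i + b i) (c i)}}"

end

theory Submission
  imports Defs
begin

text \<open>
  No variable is shared between two equations, so it suffices to solve each equation separately
  inside an arbitrary member of the ultrafilter in question.

  The key observation is that for every \<open>A \<in> p\<close> the set \<open>D\<close> of all products \<open>\<beta> g\<^sup>n\<close> with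
  \<open>\<beta>, g \<in> A\<close> again belongs to \<open>p\<close>: the geometric hypothesis applied to a member \<open>A \<inter> C\<close> of \<open>p\<close>
  shows that \<open>D\<close> meets every \<open>C \<in> p\<close>. The Brauer-type hypothesis on \<open>{h d, h \<alpha>, h \<alpha> + s d}\<close> can
  therefore be applied to \<open>A \<inter> D\<close>, and any one of the three elements it provides can be read
  as a product \<open>w z\<^sup>n\<close> with \<open>w, z \<in> A\<close>. This turns the linear equations
  \<open>a x + b y = a t\<close> and \<open>a x - a y = c t\<close> into solvable nonlinear ones with \<open>t = w z\<^sup>n\<close>
  (\<open>solution_of_ratio_summand\<close>, \<open>solution_of_opposite_coefficients\<close>), while
  \<open>a x + b y = (a + b) t\<close> is solved by \<open>x = y = t\<close> (\<open>solution_of_ratio_sum\<close>).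

  The number \<open>\<kappa>\<close> reduces the general equation to these. Replacing every variable by \<open>\<kappa>\<close> times a
  new variable and cancelling one factor \<open>\<kappa>\<close> changes \<open>a x + b y = c w z\<^sup>n\<close> into
  \<open>a x + b y = (c \<kappa>\<^sup>n) w z\<^sup>n\<close>, where \<open>c \<kappa>\<^sup>n\<close> is \<open>a\<close>, \<open>b\<close> or \<open>a + b\<close>; the new variables range over
  \<open>\<kappa>\<^sup>-\<^sup>1 A\<close>, a member of \<open>p\<close> (\<open>solution_dilate\<close>). If \<open>\<kappa> = 0\<close>, then \<open>a + b = 0\<close> because \<open>a\<close>
  and \<open>b\<close> are nonzero.

  Partition regularity follows since these ultrafilters contain \<open>R - {0}\<close>, hence one cell of
  each of its finite partitions; for \<open>\<kappa> = u/v\<close> the divisibility hypothesis enters here, as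
  \<open>\<kappa> r\<close> lies in \<open>R\<close> for every \<open>r \<in> v R\<close>.
\<close>

section \<open>Ultrafilters\<close>

lemma ultrafilter_mono: "ultrafilter p \<Longrightarrow> A \<in> p \<Longrightarrow> A \<subseteq> B \<Longrightarrow> B \<in> p"
  unfolding ultrafilter_def by blast

lemma ultrafilter_Int: "ultrafilter p \<Longrightarrow> A \<in> p \<Longrightarrow> B \<in> p \<Longrightarrow> A \<inter> B \<in> p"
  unfolding ultrafilter_def by blast

lemma ultrafilter_empty: "ultrafilter p \<Longrightarrow> {} \<notin> p"
  unfolding ultrafilter_def by blast

lemma ultrafilter_Compl: "ultrafilter p \<Longrightarrow> A \<notin> p \<Longrightarrow> - A \<in> p"
  unfolding ultrafilter_def by blast

lemma ultrafilter_UnD: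
  assumes "ultrafilter p" and "A \<union> B \<in> p"
  shows "A \<in> p \<or> B \<in> p"
proof (rule ccontr)
  assume "\<not> (A \<in> p \<or> B \<in> p)"
  then have "(A \<union> B) \<inter> (- A \<inter> - B) \<in> p"
    using assms by (blast intro: ultrafilter_Int ultrafilter_Compl)
  moreover have "(A \<union> B) \<inter> (- A \<inter> - B) = {}" by blast
  ultimately show False using ultrafilter_empty[OF assms(1)] by simp
qed

lemma ultrafilter_finite_UN:
  assumes "ultrafilter p" and "finite P" and "(\<Union>C\<in>P. f C) \<in> p"
  shows "\<exists>C\<in>P. f C \<in> p"
  using assms(2,3)
proof (induction P rule: finite_induct)
  case empty
  then show ?case using ultrafilter_empty[OF assms(1)] by simp
next
  case (insert C P)
  then show ?case using ultrafilter_UnD[OF assms(1), of "f C" "\<Union>C\<in>P. f C"] by auto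
qed

lemma ultrafilter_Compl_singleton:
  assumes "ultrafilter p" and "p \<noteq> principal_ultrafilter z"
  shows "- {z} \<in> p"
proof (rule ccontr)
  assume "- {z} \<notin> p"
  then have z: "{z} \<in> p" using ultrafilter_Compl[OF assms(1)] by fastforce
  have "A \<in> p \<longleftrightarrow> z \<in> A" for A
  proof
    assume "A \<in> p"
    then have "A \<inter> {z} \<in> p" using z assms(1) by (blast intro: ultrafilter_Int)
    then show "z \<in> A" using ultrafilter_empty[OF assms(1)] by (cases "z \<in> A") auto
  next
    assume "z \<in> A"
    then show "A \<in> p" using ultrafilter_mono[OF assms(1) z] by blast
  qed
  then show False using assms(2) unfolding principal_ultrafilter_def by blast
qed

section \<open>Single equations inside members of the ultrafilter\<close>

locale geometric_Brauer_ultrafilter =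
  fixes p :: "'a::idom set set"
  assumes uf: "ultrafilter p"
    and geo: "\<And>A l. A \<in> p \<Longrightarrow> l \<ge> (1::nat) \<Longrightarrow>
           \<exists>\<beta>\<in>A. \<exists>g\<in>A. {\<beta> * g ^ j | j. j \<in> {0..l}} \<subseteq> A"
    and brauer: "\<And>A h s. A \<in> p \<Longrightarrow> h \<noteq> 0 \<Longrightarrow> s \<noteq> 0 \<Longrightarrow>
           \<exists>\<alpha> d. {h * d, h * \<alpha>, h * \<alpha> + s * d} \<subseteq> A"
begin

text \<open>
  If the set of products were not in \<open>p\<close>, its complement intersected with \<open>A\<close> would be a member
  of \<open>p\<close> containing some \<open>\<beta>\<close>, \<open>g\<close> and \<open>\<beta> g\<^sup>n\<close>, although the last of these is a product.
\<close>

lemma geometric_products_in_ultrafilter: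
  assumes A: "A \<in> p" and n: "n \<ge> 1"
  shows "{\<beta> * g ^ n | \<beta> g. \<beta> \<in> A \<and> g \<in> A} \<in> p" (is "?D \<in> p")
proof (rule ccontr)
  assume "?D \<notin> p"
  then have "A \<inter> - ?D \<in> p" using uf A by (blast intro: ultrafilter_Int ultrafilter_Compl)
  then obtain \<beta> g where bg: "\<beta> \<in> A \<inter> - ?D" "g \<in> A \<inter> - ?D"
    and sub: "{\<beta> * g ^ j | j. j \<in> {0..n}} \<subseteq> A \<inter> - ?D"
    using geo[OF _ n] by meson
  have "\<beta> * g ^ n \<in> {\<beta> * g ^ j | j. j \<in> {0..n}}" by auto
  then have "\<beta> * g ^ n \<in> - ?D" using sub by blast
  then show False using bg by blast
qed

lemma Brauer_configuration_of_products:
  assumes A: "A \<in> p" and n: "n \<ge> 1" and hs: "h \<noteq> 0" "s \<noteq> 0"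
  obtains \<alpha> d where "{h * d, h * \<alpha>, h * \<alpha> + s * d} \<subseteq> A"
    and "{h * d, h * \<alpha>, h * \<alpha> + s * d} \<subseteq> {w * z ^ n | w z. w \<in> A \<and> z \<in> A}"
proof -
  have "A \<inter> {w * z ^ n | w z. w \<in> A \<and> z \<in> A} \<in> p"
    using ultrafilter_Int[OF uf A geometric_products_in_ultrafilter[OF A n]] by blast
  from brauer[OF this hs] show thesis using that by blast
qed

text \<open>
  The equation says \<open>a (w z\<^sup>n - x) = b y\<close>, which holds when \<open>w z\<^sup>n - x = b d\<close> and \<open>y = a d\<close>.
\<close>

lemma solution_of_ratio_summand:
  assumes A: "A \<in> p" and n: "n \<ge> 1" and ab: "a \<noteq> 0" "b \<noteq> 0"
  shows "\<exists>x\<in>A. \<exists>y\<in>A. \<exists>w\<in>A. \<exists>z\<in>A. a * x + b * y = a * w * z ^ n"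
proof -
  obtain \<alpha> d where *: "{a * d, a * \<alpha>, a * \<alpha> + b * d} \<subseteq> A"
    and products: "{a * d, a * \<alpha>, a * \<alpha> + b * d} \<subseteq> {w * z ^ n | w z. w \<in> A \<and> z \<in> A}"
    by (rule Brauer_configuration_of_products[OF A n ab])
  have "a * \<alpha> + b * d \<in> {w * z ^ n | w z. w \<in> A \<and> z \<in> A}"
    using products by (simp only: insert_subset)
  then obtain w z where wz: "w \<in> A" "z \<in> A" "a * \<alpha> + b * d = w * z ^ n" by blast
  \<comment> \<open>\<open>x = a \<alpha>\<close> and \<open>y = a d\<close>\<close>
  have "a * (a * \<alpha>) + b * (a * d) = a * (a * \<alpha> + b * d)" by (simp add: algebra_simps)
  also have "\<dots> = a * w * z ^ n" by (simp only: wz(3) mult.assoc)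
  finally show ?thesis using * wz(1,2) by blast
qed

lemma solution_of_ratio_sum:
  assumes A: "A \<in> p" and n: "n \<ge> 1"
  shows "\<exists>x\<in>A. \<exists>y\<in>A. \<exists>w\<in>A. \<exists>z\<in>A. a * x + b * y = (a + b) * w * z ^ n"
proof -
  obtain w z where wz: "w \<in> A" "z \<in> A" and "{w * z ^ j | j. j \<in> {0..n}} \<subseteq> A"
    using geo[OF A n] by blast
  then have t: "w * z ^ n \<in> A" by auto
  have "a * (w * z ^ n) + b * (w * z ^ n) = (a + b) * w * z ^ n"
    by (simp add: algebra_simps)
  then show ?thesis using wz t by blast
qed

text \<open>
  Here \<open>a (x - y) = c w z\<^sup>n\<close> holds when \<open>x - y = c d\<close> and \<open>w z\<^sup>n = a d\<close>.
\<close>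

lemma solution_of_opposite_coefficients:
  assumes A: "A \<in> p" and n: "n \<ge> 1" and ac: "a \<noteq> 0" "c \<noteq> 0" and ab: "a + b = 0"
  shows "\<exists>x\<in>A. \<exists>y\<in>A. \<exists>w\<in>A. \<exists>z\<in>A. a * x + b * y = c * w * z ^ n"
proof -
  obtain \<alpha> d where *: "{a * d, a * \<alpha>, a * \<alpha> + c * d} \<subseteq> A"
    and products: "{a * d, a * \<alpha>, a * \<alpha> + c * d} \<subseteq> {w * z ^ n | w z. w \<in> A \<and> z \<in> A}"
    by (rule Brauer_configuration_of_products[OF A n ac])
  have "a * d \<in> {w * z ^ n | w z. w \<in> A \<and> z \<in> A}"
    using products by (simp only: insert_subset)
  then obtain w z where wz: "w \<in> A" "z \<in> A" "a * d = w * z ^ n" by blast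
  \<comment> \<open>\<open>x = a \<alpha> + c d\<close> and \<open>y = a \<alpha>\<close>\<close>
  have "b = - a" using ab by (simp add: eq_neg_iff_add_eq_0 add.commute)
  then have "a * (a * \<alpha> + c * d) + b * (a * \<alpha>) = c * (a * d)" by (simp add: algebra_simps)
  also have "\<dots> = c * w * z ^ n" by (simp only: wz(3) mult.assoc)
  finally show ?thesis using * wz(1,2) by blast
qed

end

section \<open>Dilation by elements of the fraction field\<close>

text \<open>
  If \<open>x = \<kappa> x'\<close>, \<open>y = \<kappa> y'\<close>, \<open>w = \<kappa> w'\<close>, \<open>z = \<kappa> z'\<close>, then the right-hand side picks up the factor
  \<open>\<kappa>\<^sup>n\<^sup>+\<^sup>1\<close> and the left-hand side only \<open>\<kappa>\<close>; the surplus \<open>\<kappa>\<^sup>n = m/c\<close> exchanges \<open>m\<close> for \<open>c\<close>.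
\<close>

lemma solution_dilate:
  fixes a b c m :: "'a::idom"
  assumes \<kappa>: "\<kappa> ^ n = Fract m c" and c: "c \<noteq> 0"
    and sol: "\<exists>x\<in>B. \<exists>y\<in>B. \<exists>w\<in>B. \<exists>z\<in>B. a * x + b * y = m * w * z ^ n"
    and B: "B = inv_dilate \<kappa> A"
  shows "\<exists>x\<in>A. \<exists>y\<in>A. \<exists>w\<in>A. \<exists>z\<in>A. a * x + b * y = c * w * z ^ n"
proof -
  have lift: "\<exists>r\<in>A. to_fract r = \<kappa> * to_fract r'" if "r' \<in> B" for r'
    using that unfolding B inv_dilate_def by fastforce
  obtain x' y' w' z' where B': "x' \<in> B" "y' \<in> B" "w' \<in> B" "z' \<in> B"
    and eq: "a * x' + b * y' = m * w' * z' ^ n"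
    using sol by blast
  obtain x y w z where A: "x \<in> A" "y \<in> A" "w \<in> A" "z \<in> A"
    and scaled: "to_fract x = \<kappa> * to_fract x'" "to_fract y = \<kappa> * to_fract y'"
      "to_fract w = \<kappa> * to_fract w'" "to_fract z = \<kappa> * to_fract z'"
    using lift[OF B'(1)] lift[OF B'(2)] lift[OF B'(3)] lift[OF B'(4)] by blast
  have m: "to_fract m = to_fract c * \<kappa> ^ n"
    using c unfolding \<kappa> by (simp add: to_fract_def eq_fract)
  have power: "to_fract (r ^ n) = to_fract r ^ n" for r :: 'a
    by (induction n) simp_all
  have "to_fract (a * x + b * y) = \<kappa> * to_fract (a * x' + b * y')"
    by (simp add: scaled algebra_simps)
  also have "\<dots> = to_fract (c * w * z ^ n)"
    unfolding eq by (simp add: scaled m power algebra_simps)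
  finally have "a * x + b * y = c * w * z ^ n" by (simp only: to_fract_eq_iff)
  then show ?thesis using A by blast
qed

text \<open>
  With \<open>\<kappa> = u/v\<close>, every nonzero multiple of \<open>v\<close> is sent by \<open>\<kappa>\<close> to a nonzero element of \<open>R\<close>.
\<close>

lemma inv_dilate_nonzero_in_ultrafilter:
  fixes p :: "'a::idom set set"
  assumes uf: "ultrafilter p" and nz: "- {0} \<in> p"
    and mult: "\<forall>\<alpha>. \<alpha> \<noteq> 0 \<longrightarrow> {\<alpha> * r | r. r \<in> UNIV} \<in> p"
    and \<kappa>: "\<kappa> \<noteq> 0"
  shows "inv_dilate \<kappa> (UNIV - {0}) \<in> p"
proof -
  obtain u v where uv: "\<kappa> = Fract u v" "v \<noteq> 0" by (cases \<kappa>)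
  have u: "u \<noteq> 0" using \<kappa> uv by (auto simp: fract_collapse)
  have "{v * r | r. r \<in> UNIV} \<inter> - {0} \<in> p"
    using mult uv(2) by (intro ultrafilter_Int[OF uf _ nz]) blast
  moreover have "{v * r | r. r \<in> UNIV} \<inter> - {0} \<subseteq> inv_dilate \<kappa> (UNIV - {0})"
  proof
    fix t assume "t \<in> {v * r | r. r \<in> UNIV} \<inter> - {0}"
    then obtain r where r: "t = v * r" "r \<noteq> 0" by auto
    have "\<kappa> * to_fract t = to_fract (u * r)"
      using uv by (simp add: r to_fract_def eq_fract algebra_simps)
    moreover have "u * r \<in> UNIV - {0}" using u r by simp
    ultimately show "t \<in> inv_dilate \<kappa> (UNIV - {0})" unfolding inv_dilate_def by blast
  qed
  ultimately show ?thesis using ultrafilter_mono[OF uf] by blast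
qed

lemma inv_dilate_Union: "inv_dilate \<kappa> (\<Union>P) = (\<Union>C\<in>P. inv_dilate \<kappa> C)"
  unfolding inv_dilate_def by blast

section \<open>The whole system\<close>

lemma solvable_in_eqn_systemI:
  assumes "\<And>i. i \<in> {1..k} \<Longrightarrow>
    \<exists>x\<in>A. \<exists>y\<in>A. \<exists>w\<in>A. \<exists>z\<in>A. a i * x + b i * y = c i * w * z ^ n i"
  shows "solvable_in (vars k) (eqn_system k a b c n) A"
proof -
  have "\<forall>i\<in>{1..k}. \<exists>x y w z. x \<in> A \<and> y \<in> A \<and> w \<in> A \<and> z \<in> A \<and>
      a i * x + b i * y = c i * w * z ^ n i"
    using assms by blast
  then obtain x y w z where *: "\<forall>i\<in>{1..k}. x i \<in> A \<and> y i \<in> A \<and> w i \<in> A \<and> z i \<in> A \<and>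
      a i * x i + b i * y i = c i * w i * z i ^ n i"
    unfolding bchoice_iff by blast
  define s where "s v = (case v of X i \<Rightarrow> x i | Y i \<Rightarrow> y i | W i \<Rightarrow> w i | Z i \<Rightarrow> z i)" for v
  have "\<forall>v\<in>vars k. s v \<in> A" using * by (auto simp: vars_def s_def)
  moreover have "eqn_system k a b c n s" using * by (simp add: eqn_system_def s_def)
  ultimately show ?thesis unfolding solvable_in_def by blast
qed

theorem theorem16:
  fixes p :: "'a::idom set set"
    and k :: nat
    and a b c :: "nat \<Rightarrow> 'a"
    and n :: "nat \<Rightarrow> nat"
  assumes "ultrafilter p"
    and "p \<noteq> principal_ultrafilter 0"
    and "\<And>A l. A \<in> p \<Longrightarrow> l \<ge> (1::nat) \<Longrightarrow>
           \<exists>\<beta>\<in>A. \<exists>g\<in>A. {\<beta> * g ^ j | j. j \<in> {0..l}} \<subseteq> A"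
    and "\<And>A h s. A \<in> p \<Longrightarrow> h \<noteq> 0 \<Longrightarrow> s \<noteq> 0 \<Longrightarrow>
           \<exists>\<alpha> d. {h * d, h * \<alpha>, h * \<alpha> + s * d} \<subseteq> A"
    and "\<And>\<alpha>. \<alpha> \<noteq> 0 \<Longrightarrow> {\<alpha> * r | r. r \<in> UNIV} \<in> p"
    and "k \<ge> 1"
    and "\<And>i. i \<in> {1..k} \<Longrightarrow> a i \<noteq> 0 \<and> b i \<noteq> 0 \<and> c i \<noteq> 0"
    and "\<And>i. i \<in> {1..k} \<Longrightarrow> n i \<ge> 1"
    and "ratio_set k a b c n \<noteq> {}"
  shows "(0 \<in> ratio_set k a b c n \<longrightarrow>
            (\<forall>A\<in>p. solvable_in (vars k) (eqn_system k a b c n) A))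
       \<and> (\<forall>\<kappa> \<in> ratio_set k a b c n - {0}. \<forall>A\<in>dilate_ultrafilter \<kappa> p.
            solvable_in (vars k) (eqn_system k a b c n) A)
       \<and> partition_regular_over (vars k) (eqn_system k a b c n) (UNIV - {0})"
proof -
  interpret geometric_Brauer_ultrafilter p
    by unfold_locales (fact assms)+
  note nonzero = assms(7) and n_pos = assms(8)
  let ?I = "ratio_set k a b c n"
  let ?solvable = "solvable_in (vars k) (eqn_system k a b c n)"
  have zero: "?solvable A" if "0 \<in> ?I" and A: "A \<in> p" for A
  proof (rule solvable_in_eqn_systemI)
    fix i assume i: "i \<in> {1..k}"
    have "0 ^ n i \<in> {Fract (a i) (c i), Fract (b i) (c i), Fract (a i + b i) (c i)}"
      using that(1) i unfolding ratio_set_def by blast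
    moreover have "(0 :: 'a fract) ^ n i = 0" using n_pos[OF i] by (simp add: zero_power)
    moreover have "m = 0" if "0 = Fract m (c i)" for m
      using that nonzero[OF i] by (simp add: Zero_fract_def eq_fract)
    ultimately have "a i + b i = 0" using nonzero[OF i] by auto
    then show "\<exists>x\<in>A. \<exists>y\<in>A. \<exists>w\<in>A. \<exists>z\<in>A. a i * x + b i * y = c i * w * z ^ n i"
      using nonzero[OF i]
      by (intro solution_of_opposite_coefficients[OF A n_pos[OF i]]) auto
  qed
  have dilated: "?solvable A" if \<kappa>: "\<kappa> \<in> ?I" and A: "inv_dilate \<kappa> A \<in> p" for \<kappa> A
  proof (rule solvable_in_eqn_systemI)
    fix i assume i: "i \<in> {1..k}"
    let ?B = "inv_dilate \<kappa> A"
    note nz = nonzero[OF i]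
    obtain m where power: "\<kappa> ^ n i = Fract m (c i)"
      and sol: "\<exists>x\<in>?B. \<exists>y\<in>?B. \<exists>w\<in>?B. \<exists>z\<in>?B. a i * x + b i * y = m * w * z ^ n i"
    proof -
      have "\<exists>x\<in>?B. \<exists>y\<in>?B. \<exists>w\<in>?B. \<exists>z\<in>?B. a i * x + b i * y = a i * w * z ^ n i"
        using nz by (intro solution_of_ratio_summand[OF A n_pos[OF i]]) auto
      moreover have "\<exists>y\<in>?B. \<exists>x\<in>?B. \<exists>w\<in>?B. \<exists>z\<in>?B. b i * y + a i * x = b i * w * z ^ n i"
        using nz by (intro solution_of_ratio_summand[OF A n_pos[OF i]]) auto
      then have "\<exists>x\<in>?B. \<exists>y\<in>?B. \<exists>w\<in>?B. \<exists>z\<in>?B. a i * x + b i * y = b i * w * z ^ n i"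
        by (subst add.commute) blast
      moreover have
        "\<exists>x\<in>?B. \<exists>y\<in>?B. \<exists>w\<in>?B. \<exists>z\<in>?B. a i * x + b i * y = (a i + b i) * w * z ^ n i"
        using solution_of_ratio_sum[OF A n_pos[OF i]] .
      moreover have
        "\<kappa> ^ n i \<in> {Fract (a i) (c i), Fract (b i) (c i), Fract (a i + b i) (c i)}"
        using \<kappa> i unfolding ratio_set_def by blast
      ultimately show thesis using that by blast
    qed
    show "\<exists>x\<in>A. \<exists>y\<in>A. \<exists>w\<in>A. \<exists>z\<in>A. a i * x + b i * y = c i * w * z ^ n i"
      by (rule solution_dilate[OF power _ sol refl]) (use nz in blast)
  qed
  have "\<exists>C\<in>P. ?solvable C" if P: "finite P" "partition_on (UNIV - {0}) P" for P
  proof -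
    have cover: "\<Union>P = UNIV - {0}" using P(2) by (simp add: partition_on_def)
    have mult: "\<forall>\<alpha>. \<alpha> \<noteq> 0 \<longrightarrow> {\<alpha> * r | r. r \<in> UNIV} \<in> p" using assms(5) by blast
    have nz: "- {0} \<in> p" using ultrafilter_Compl_singleton[OF uf assms(2)] .
    obtain \<kappa> where \<kappa>: "\<kappa> \<in> ?I" using assms(9) by blast
    show ?thesis
    proof (cases "\<kappa> = 0")
      case True
      have "(\<Union>C\<in>P. C) \<in> p" using nz cover by (simp add: Compl_eq_Diff_UNIV)
      then show ?thesis using ultrafilter_finite_UN[OF uf P(1), of "\<lambda>C. C"] zero \<kappa> True by blast
    next
      case False
      then have "(\<Union>C\<in>P. inv_dilate \<kappa> C) \<in> p"
        using inv_dilate_nonzero_in_ultrafilter[OF uf nz mult] cover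
        by (simp flip: inv_dilate_Union)
      then show ?thesis using ultrafilter_finite_UN[OF uf P(1)] dilated[OF \<kappa>] by blast
    qed
  qed
  then show ?thesis
    using zero dilated unfolding partition_regular_over_def dilate_ultrafilter_def by blast
qed

end
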